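(* Let $n,q\ge 1$, let $\mathbf{F}:\mathbb{R}^n\to\mathbb{R}^q$ be linear, let $\Gamma_{\mathrm{noise}}\in\mathbb{R}^{q\times q}$ and $\Gamma_{\mathrm{pr}}\in\mathbb{R}^{n\times n}$ be symmetric positive definite, and let $m_{\mathrm{pr}}\in\mathbb{R}^n$. Consider the Bayesian linear inverse problem of inferring $m\in\mathbb{R}^n$ from $y=\mathbf{F}m+\eta$, where $\eta\sim\mathcal{N}(0,\Gamma_{\mathrm{noise}})$ is independent of $m$ and $m$ has prior law $\mu_{\mathrm{pr}}=\mathcal{N}(m_{\mathrm{pr}},\Gamma_{\mathrm{pr}})$. For $y\in\mathbb{R}^q$ let $\mu_{\mathrm{post}}^y=\mathcal{N}(m_{\mathrm{post}}^y,\Gamma_{\mathrm{post}})$ be the posterior measure, where $$\Gamma_{\mathrm{post}}=(\mathbf{F}^{\mathsf T}\Gamma_{\mathrm{noise}}^{-1}\mathbf{F}+\Gamma_{\mathrm{pr}}^{-1})^{-1},\qquad m_{\mathrm{post}}^y=\Gamma_{\mathrm{post}}\big(\mathbf{F}^{\mathsf T}\Gamma_{\mathrm{noise}}^{-1}y+\Gamma_{\mathrm{pr}}^{-1}m_{\mathrm{pr}}\big).$$ Then the expected information gain $$\overline{D}_{\mathrm{kl}}(\mu_{\mathrm{post}}\|\mu_{\mathrm{pr}}):=\mathsf{E}_{\mu_{\mathrm{pr}}}\big\{\mathsf{E}_{y|m}\{D_{\mathrm{kl}}(\mu_{\mathrm{post}}^y\|\mu_{\mathrm{pr}})\}\big\}$$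 satisfies $$\overline{D}_{\mathrm{kl}}(\mu_{\mathrm{post}}\|\mu_{\mathrm{pr}})=-\tfrac12\log\det(\Gamma_{\mathrm{post}})+\tfrac12\log\det(\Gamma_{\mathrm{pr}}).$$
   Context: $\mathcal{N}(a,\Sigma)$ denotes the Gaussian measure with mean $a$ and covariance matrix $\Sigma$. The inner expectation $\mathsf{E}_{y|m}$ is over $y\sim\mathcal{N}(\mathbf{F}m,\Gamma_{\mathrm{noise}})$ for fixed $m$ (the law of the data given $m$), and the outer expectation $\mathsf{E}_{\mu_{\mathrm{pr}}}$ is over $m\sim\mu_{\mathrm{pr}}$. $D_{\mathrm{kl}}(\mu_1\|\mu_2)$ is the Kullback–Leibler divergence $\int\log\frac{d\mu_1}{d\mu_2}\,d\mu_1$ from $\mu_1$ to $\mu_2$; for Gaussian measures $\mu_i=\mathcal{N}(a_i,\Sigma_i)$ on $\mathbb{R}^n$ with $\Sigma_i$ positive definite it is given by $$D_{\mathrm{kl}}(\mu_1\|\mu_2)=\tfrac12\Big[-\log\Big(\frac{\det\Sigma_1}{\det\Sigma_2}\Big)-n+\operatorname{tr}(\Sigma_2^{-1}\Sigma_1)+(a_1-a_2)^{\mathsf T}\Sigma_2^{-1}(a_1-a_2)\Big].$$ *)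

theory Defs
  imports "HOL-Probability.Probability"
begin

definition spd :: "real^'n^'n \<Rightarrow> bool" where
  "spd A \<longleftrightarrow> transpose A = A \<and> (\<forall>x. x \<noteq> 0 \<longrightarrow> 0 < x \<bullet> (A *v x))"

text \<open>The nondegenerate Gaussian measure with mean \<open>a\<close> and covariance matrix \<open>\<Sigma>\<close>,
  given by its Lebesgue density. It is only meaningful for positive definite \<open>\<Sigma>\<close>.\<close>

definition gaussian_measure :: "real^'n \<Rightarrow> real^'n^'n \<Rightarrow> (real^'n) measure" where
  "gaussian_measure a \<Sigma> = density lborel (\<lambda>x. ennreal
     (exp (- (1/2) * ((x - a) \<bullet> (matrix_inv \<Sigma> *v (x - a)))) /
      sqrt ((2 * pi) ^ CARD('n) * det \<Sigma>)))"

text \<open>The library's \<open>KL_divergence b M N\<close> integrates \<open>log b (dN/dM)\<close> against \<open>N\<close>,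
  so its measure arguments appear in the opposite order here.\<close>

definition D_kl :: "'a measure \<Rightarrow> 'a measure \<Rightarrow> real" where
  "D_kl \<mu>1 \<mu>2 = KL_divergence (exp 1) \<mu>2 \<mu>1"

definition post_cov ::
  "(real^'n \<Rightarrow> real^'q) \<Rightarrow> real^'q^'q \<Rightarrow> real^'n^'n \<Rightarrow> real^'n^'n" where
  "post_cov F \<Gamma>noise \<Gamma>pr =
     matrix_inv (transpose (matrix F) ** matrix_inv \<Gamma>noise ** matrix F + matrix_inv \<Gamma>pr)"

definition post_mean ::
  "(real^'n \<Rightarrow> real^'q) \<Rightarrow> real^'q^'q \<Rightarrow> real^'n^'n \<Rightarrow> real^'n \<Rightarrow> real^'q \<Rightarrow> real^'n" where
  "post_mean F \<Gamma>noise \<Gamma>pr mpr y =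
     post_cov F \<Gamma>noise \<Gamma>pr *v
       ((transpose (matrix F) ** matrix_inv \<Gamma>noise) *v y + matrix_inv \<Gamma>pr *v mpr)"

definition posterior ::
  "(real^'n \<Rightarrow> real^'q) \<Rightarrow> real^'q^'q \<Rightarrow> real^'n^'n \<Rightarrow> real^'n \<Rightarrow> real^'q \<Rightarrow> (real^'n) measure" where
  "posterior F \<Gamma>noise \<Gamma>pr mpr y =
     gaussian_measure (post_mean F \<Gamma>noise \<Gamma>pr mpr y) (post_cov F \<Gamma>noise \<Gamma>pr)"

definition expected_information_gain ::
  "(real^'n \<Rightarrow> real^'q) \<Rightarrow> real^'q^'q \<Rightarrow> real^'n^'n \<Rightarrow> real^'n \<Rightarrow> real" where
  "expected_information_gain F \<Gamma>noise \<Gamma>pr mpr =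
     (LINT m|gaussian_measure mpr \<Gamma>pr.
        (LINT y|gaussian_measure (F m) \<Gamma>noise.
           D_kl (posterior F \<Gamma>noise \<Gamma>pr mpr y) (gaussian_measure mpr \<Gamma>pr)))"

end

theory Submission
  imports Defs
begin

text \<open>
  The divergence of two Gaussian measures is a constant plus a quadratic form in the difference of the
  means, and the difference of posterior and prior mean is a linear function of \<open>y - F mpr\<close>.
  So both expectations are expectations of quadratic forms under Gaussian measures, which are given by
  \<open>tr (Q \<Sigma>) + (a - c)\<^sup>T Q (a - c)\<close>. The resulting traces add up to the dimension, which cancels
  the dimension in the divergence and leaves the two log-determinants.
\<close>

subsection \<open>Symmetric positive definite matrices\<close>

text \<open>Write \<open>M\<close> for the matrix of \<open>F\<close>, \<open>N\<close> and
  \<open>C\<close> for noise and prior covariance, \<open>P\<close> for the posterior covariance.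
  That the traces add up to the dimension is the law of total covariance: averaged over prior and
  noise, \<open>y\<close> has mean \<open>F mpr\<close> and covariance
  \<open>N + M C M\<^sup>T\<close>, and the posterior mean then has covariance \<open>C - P\<close>
  around \<open>mpr\<close>, so the total is \<open>tr (C\<^sup>-\<^sup>1 P) + tr (C\<^sup>-\<^sup>1
  (C - P)) = n\<close>. The obstacle is analytic. The measures are given only by densities, so each
  expectation is reduced to a standard Gaussian, whose density factors over the coordinates. The
  reduction is the substitution \<open>x = L z + a\<close> with \<open>S = L L\<^sup>T\<close>,
  which calls for the factorization and for a linear change of variables. Integrals of nonintegrable
  functions default to 0; \<open>has_bochner_integral\<close> carries integrability along with each
  value.\<close>

lemma matrix_inv_both:
  fixes A :: "real^'n^'n"
  assumes "invertible A"
  shows "A ** matrix_inv A = mat 1" "matrix_inv A ** A = mat 1"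
  using someI_ex[OF assms[unfolded invertible_def]] by (auto simp: matrix_inv_def)

lemma matrix_inv_eqI:
  fixes A :: "real^'n^'n"
  assumes "A ** B = mat 1"
  shows "matrix_inv A = B"
proof -
  have "invertible A" using assms invertible_right_inverse by blast
  then have "matrix_inv A ** A ** B = B" by (simp add: matrix_inv_both)
  then show ?thesis by (simp add: assms flip: matrix_mul_assoc)
qed

lemma inner_matrix_vector_mult:
  fixes A :: "real^'n^'m"
  shows "x \<bullet> (A *v y) = (transpose A *v x) \<bullet> y"
  by (simp add: dot_lmul_matrix)

text \<open>Gram--Schmidt for the inner product \<open>x \<bullet> (A *v y)\<close> gives a matrix \<open>P\<close> with
  \<open>P\<^sup>T A P = 1\<close>; then \<open>L = P\<^sup>-\<^sup>T\<close>.\<close>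

lemma spd_factor_exists:
  fixes A :: "real^'n^'n"
  assumes "spd A"
  obtains L :: "real^'n^'n" where "invertible L" "A = L ** transpose L"
proof -
  have sym: "x \<bullet> (A *v y) = y \<bullet> (A *v x)" for x y
    using assms unfolding spd_def
    by (metis dot_lmul_matrix inner_commute vector_transpose_matrix)
  have pos: "0 < x \<bullet> (A *v x)" if "x \<noteq> 0" for x
    using assms that by (auto simp: spd_def)
  define ON where "ON B \<longleftrightarrow> finite B \<and> (\<forall>x\<in>B. \<forall>y\<in>B. x \<bullet> (A *v y) = (if x = y then 1 else 0))" for B
  have "\<exists>B. ON B \<and> card B = k" if "k \<le> CARD('n)" for k
    using that
  proof (induction k)
    case 0
    then show ?case by (intro exI[of _ "{}"]) (auto simp: ON_def)
  next
    case (Suc k)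
    then obtain B where B: "ON B" and card: "card B = k" by auto
    have fin: "finite B" and on: "x \<in> B \<Longrightarrow> y \<in> B \<Longrightarrow> x \<bullet> (A *v y) = (if x = y then 1 else 0)" for x y
      using B by (auto simp: ON_def)
    \<comment> \<open>Fewer than \<open>CARD('n)\<close> vectors cannot span, so some
      \<open>v\<close> lies outside. Removing its \<open>A\<close>-projection onto
      \<open>span B\<close> leaves a nonzero vector \<open>w\<close> that is
      \<open>A\<close>-orthogonal to \<open>B\<close>.\<close>
    have "dim (span B) \<le> card B" using fin by (simp add: dim_le_card')
    with card Suc.prems have "span B \<noteq> UNIV"
      by (metis DIM_cart DIM_real dim_UNIV mult.right_neutral not_less_eq_eq)
    then obtain v where v: "v \<notin> span B" by blast
    define w where "w = v - (\<Sum>b\<in>B. (b \<bullet> (A *v v)) *\<^sub>R b)"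
    have S: "(\<Sum>b\<in>B. (b \<bullet> (A *v v)) *\<^sub>R b) \<in> span B"
      by (intro span_sum span_scale span_base)
    have w: "w \<notin> span B"
      using v S span_add[of w B "(\<Sum>b\<in>B. (b \<bullet> (A *v v)) *\<^sub>R b)"] by (auto simp: w_def)
    then have w0: "w \<noteq> 0" using span_0 by blast
    have wo: "x \<bullet> (A *v w) = 0" if "x \<in> B" for x
    proof -
      have "x \<bullet> (A *v w) = x \<bullet> (A *v v) - (\<Sum>b\<in>B. (b \<bullet> (A *v v)) * (x \<bullet> (A *v b)))"
        by (simp add: w_def matrix_vector_mult_diff_distrib inner_diff_right inner_sum_right
            matrix_vector_mult_scaleR linear_sum[OF matrix_vector_mul_linear])
      also have "(\<Sum>b\<in>B. (b \<bullet> (A *v v)) * (x \<bullet> (A *v b))) = (\<Sum>b\<in>B. if b = x then b \<bullet> (A *v v) else 0)"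
        using that by (intro sum.cong) (auto simp: on)
      finally show ?thesis using fin that by simp
    qed
    define u where "u = (1 / sqrt (w \<bullet> (A *v w))) *\<^sub>R w"
    have uu: "u \<bullet> (A *v u) = 1"
      using pos[OF w0] by (simp add: u_def matrix_vector_mult_scaleR)
    have uB: "u \<notin> B"
    proof
      assume "u \<in> B"
      then have "sqrt (w \<bullet> (A *v w)) *\<^sub>R u \<in> span B" by (intro span_scale span_base)
      then show False using w pos[OF w0] by (simp add: u_def)
    qed
    have uo: "x \<bullet> (A *v u) = 0" if "x \<in> B" for x
      using wo[OF that] by (simp add: u_def matrix_vector_mult_scaleR)
    have "ON (insert u B)"
      using fin on uu uo uB sym by (auto simp: ON_def)
    then show ?case using fin uB card by (intro exI[of _ "insert u B"]) auto
  qed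
  from this[of "CARD('n)"] obtain B where B: "ON B" "card B = CARD('n)" by auto
  then obtain h where h: "bij_betw h (UNIV::'n set) B"
    using finite_same_card_bij[of "UNIV::'n set" B] by (auto simp: ON_def)
  have hh: "h i \<bullet> (A *v h j) = (if i = j then 1 else 0)" for i j
    using B(1) h by (auto simp: ON_def bij_betw_def inj_eq)
  define P :: "real^'n^'n" where "P = (\<chi> i j. h j $ i)"
  have colP: "column j P = h j" for j by (simp add: P_def column_def vec_eq_iff)
  have "(transpose P ** A ** P) $ i $ j = mat 1 $ i $ j" for i j
  proof -
    \<comment> \<open>An entry is the bilinear form at two unit vectors, hence the form of
      \<open>A\<close> at the columns \<open>h i\<close> and \<open>h j\<close>.\<close>
    have "(transpose P ** A ** P) $ i $ j = axis i 1 \<bullet> ((transpose P ** A ** P) *v axis j 1)"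
      by (simp add: matrix_vector_mult_basis column_def inner_axis')
    also have "\<dots> = (P *v axis i 1) \<bullet> (A *v (P *v axis j 1))"
      by (simp add: matrix_vector_mul_assoc[symmetric] inner_matrix_vector_mult del: transpose_matrix_vector)
    finally show ?thesis by (simp add: matrix_vector_mult_basis colP hh mat_def)
  qed
  then have one: "transpose P ** A ** P = mat 1" by (simp add: vec_eq_iff)
  then have inv: "invertible P"
    using invertible_left_inverse by blast
  define R where "R = matrix_inv P"
  have R: "P ** R = mat 1" "R ** P = mat 1" using inv by (simp_all add: R_def matrix_inv_both)
  have tR: "transpose R ** transpose P = mat 1"
    by (metis R(1) matrix_transpose_mul transpose_mat)
  have "A = (transpose R ** transpose P) ** A ** (P ** R)"
    by (simp add: R tR)
  also have "\<dots> = transpose R ** (transpose P ** A ** P) ** R"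
    by (simp add: matrix_mul_assoc)
  finally have "A = transpose R ** transpose (transpose R)" by (simp add: one)
  moreover have "invertible (transpose R)"
    using tR invertible_right_inverse by blast
  ultimately show thesis using that by blast
qed

text \<open>With \<open>A = L L\<^sup>T\<close> the determinant is the square of
  \<open>det L\<close>, which is nonzero.\<close>

lemma spd_det_pos: "spd A \<Longrightarrow> 0 < det A"
  by (erule spd_factor_exists) (auto simp: det_mul invertible_det_nz zero_less_mult_iff linorder_neq_iff)

lemma spd_invertible: "spd A \<Longrightarrow> invertible A"
  using spd_det_pos[of A] by (auto simp: invertible_det_nz)

lemma matrix_inv_transpose:
  fixes A :: "real^'n^'n"
  assumes "invertible A"
  shows "matrix_inv (transpose A) = transpose (matrix_inv A)"
  using matrix_inv_both[OF assms]
  by (intro matrix_inv_eqI) (simp flip: matrix_transpose_mul)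

text \<open>Substituting \<open>x = A y\<close> turns the form of the inverse at \<open>x\<close>
  into the form of \<open>A\<close> at \<open>y\<close>.\<close>

lemma spd_matrix_inv:
  assumes "spd A"
  shows "spd (matrix_inv A)"
  unfolding spd_def
proof safe
  note inv = matrix_inv_both[OF spd_invertible[OF assms]]
  show "transpose (matrix_inv A) = matrix_inv A"
    using assms spd_invertible[OF assms] matrix_inv_transpose by (metis spd_def)
  fix x :: "real^'a" assume x: "x \<noteq> 0"
  define y where "y = matrix_inv A *v x"
  have xy: "x = A *v y" by (simp add: y_def matrix_vector_mul_assoc inv)
  then have "y \<noteq> 0" using x by auto
  then have "0 < y \<bullet> (A *v y)" using assms by (auto simp: spd_def)
  then show "0 < x \<bullet> (matrix_inv A *v x)" by (simp add: xy[symmetric] y_def[symmetric] inner_commute)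
qed

lemma transpose_matrix_add: "transpose (A + B) = transpose A + transpose B"
  by (simp add: transpose_def vec_eq_iff)

lemma matrix_add_rdistrib:
  fixes A B :: "'a::semiring_1^'n^'m"
  shows "(A + B) ** C = A ** C + B ** C"
  by (simp add: matrix_matrix_mult_def vec_eq_iff distrib_right sum.distrib)

text \<open>\<open>M\<close> may have a kernel, so the congruence term is only semidefinite;
  strictness comes from \<open>C\<close>. Applied to inverse covariances, this makes the posterior
  precision invertible.\<close>

lemma spd_add_congruence:
  fixes M :: "real^'n^'q"
  assumes "spd N" "spd C"
  shows "spd (transpose M ** N ** M + C)"
  unfolding spd_def
proof safe
  show "transpose (transpose M ** N ** M + C) = transpose M ** N ** M + C"
    using assms by (simp add: spd_def transpose_matrix_add matrix_transpose_mul matrix_mul_assoc)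
  fix x :: "real^'n" assume x: "x \<noteq> 0"
  have "0 \<le> (M *v x) \<bullet> (N *v (M *v x))"
    using assms(1) by (cases "M *v x = 0") (auto simp: spd_def less_imp_le)
  also have "\<dots> = x \<bullet> ((transpose M ** N ** M) *v x)"
    by (simp add: matrix_vector_mul_assoc[symmetric] inner_matrix_vector_mult del: transpose_matrix_vector)
  finally show "0 < x \<bullet> ((transpose M ** N ** M + C) *v x)"
    using assms(2) x by (simp add: spd_def matrix_vector_mult_add_rdistrib inner_add_right add_nonneg_pos)
qed

subsection \<open>Linear change of variables\<close>

lemma borel_measurable_linear:
  fixes f :: "real^'n \<Rightarrow> real^'m"
  shows "linear f \<Longrightarrow> f \<in> borel_measurable borel"
  by (intro borel_measurable_continuous_onI linear_continuous_on) (simp add: linear_conv_bounded_linear)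

text \<open>Lebesgue measure is determined by its values on open boxes. The criterion serves the
  volume-preserving elementary maps, namely coordinate swaps and shears.\<close>

lemma nn_integral_lborel_eqI:
  fixes T :: "real^'n \<Rightarrow> real^'n"
  assumes "T \<in> borel_measurable borel"
    and "\<And>l u. cbox l u \<noteq> {} \<Longrightarrow> emeasure lborel (T -` box l u) = emeasure lborel (box l u)"
    and "h \<in> borel_measurable borel"
  shows "(\<integral>\<^sup>+x. h x \<partial>lborel) = (\<integral>\<^sup>+x. h (T x) \<partial>lborel)"
proof -
  have eq: "lborel = distr lborel borel T"
  proof (rule lborel_eqI)
    fix l u :: "real^'n" assume le: "\<And>b. b \<in> Basis \<Longrightarrow> l \<bullet> b \<le> u \<bullet> b"
    then have "cbox l u \<noteq> {}" by (simp add: box_ne_empty)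
    then have "emeasure (distr lborel borel T) (box l u) = emeasure lborel (box l u)"
      using assms(1,2) by (simp add: emeasure_distr)
    then show "emeasure (distr lborel borel T) (box l u) = (\<Prod>b\<in>Basis. (u - l) \<bullet> b)"
      by (simp only: emeasure_lborel_box[OF le])
  qed simp
  have "(\<integral>\<^sup>+x. h x \<partial>distr lborel borel T) = (\<integral>\<^sup>+x. h (T x) \<partial>lborel)"
    using assms(1,3) by (simp add: nn_integral_distr)
  then show ?thesis by (simp only: eq[symmetric])
qed

lemma emeasure_lborel_box_cart:
  fixes l u :: "real^'n"
  assumes "cbox l u \<noteq> {}"
  shows "emeasure lborel (box l u) = ennreal (\<Prod>i\<in>UNIV. u $ i - l $ i)"
  using assms by (simp add: emeasure_lborel_box_eq box_ne_empty Basis_vec_def cart_eq_inner_axis axis_eq_axis prod.UNION_disjoint inner_diff_left)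

lemma measure_shear_cbox:
  fixes a b :: "real^'n"
  assumes "m \<noteq> n"
  shows "measure lebesgue ((\<lambda>x. \<chi> i. if i = m then x$m + x$n else x$i) ` cbox a b) = measure lebesgue (cbox a b)"
proof (cases "cbox a b = {}")
  case False
  let ?h = "\<lambda>x::real^'n. \<chi> i. if i = m then x$m + x$n else x$i"
  \<comment> \<open>\<open>measure_shear_interval\<close> asks for a nonnegative lower end in
    coordinate \<open>n\<close>; this translation moves that end to 0.\<close>
  define v :: "real^'n" where "v = axis n (- a$n)"
  have eq: "?h ` cbox (v + a) (v + b) = (+) (?h v) ` ?h ` cbox a b"
    unfolding cbox_translation image_image
    by (intro image_cong) (auto simp: vec_eq_iff)
  have "measure lebesgue (?h ` cbox a b) = measure lebesgue (?h ` cbox (v + a) (v + b))"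
    unfolding eq by (rule measure_translation[symmetric])
  also have "\<dots> = measure lebesgue (cbox (v + a) (v + b))"
    using False \<open>m \<noteq> n\<close> by (intro measure_shear_interval) (auto simp: cbox_translation v_def)
  also have "\<dots> = measure lebesgue (cbox a b)"
    unfolding cbox_translation by (rule measure_translation)
  finally show ?thesis .
qed simp

text \<open>The library's change of variables for linear maps needs a well-ordered index type, because it
  evaluates the determinant of a shear as that of a triangular matrix.\<close>

proposition nn_integral_linear_image:
  fixes f :: "real^'n \<Rightarrow> real^'n"
  assumes "linear f" "det (matrix f) \<noteq> 0" "h \<in> borel_measurable borel"
  shows "(\<integral>\<^sup>+x. h x \<partial>lborel) = ennreal \<bar>det (matrix f)\<bar> * (\<integral>\<^sup>+x. h (f x) \<partial>lborel)"
proof -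
  \<comment> \<open>The induction needs all \<open>h\<close> at once, because a composition uses the
    hypothesis for \<open>g\<close> at \<open>h\<close> composed with \<open>f\<close>.
    Nonsingularity is an implication because the elementary maps include singular ones.\<close>
  have "\<forall>h \<in> borel_measurable borel. det (matrix f) \<noteq> 0 \<longrightarrow>
     (\<integral>\<^sup>+x. h x \<partial>lborel) = ennreal \<bar>det (matrix f)\<bar> * (\<integral>\<^sup>+x. h (f x) \<partial>lborel)"
  proof (rule induct_linear_elementary [OF \<open>linear f\<close>]; intro ballI impI)
    fix f g :: "real^'n \<Rightarrow> real^'n" and h :: "real^'n \<Rightarrow> ennreal"
    assume lin: "linear f" "linear g" and h: "h \<in> borel_measurable borel"
      and f: "\<forall>h \<in> borel_measurable borel. det (matrix f) \<noteq> 0 \<longrightarrow>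
        (\<integral>\<^sup>+x. h x \<partial>lborel) = ennreal \<bar>det (matrix f)\<bar> * (\<integral>\<^sup>+x. h (f x) \<partial>lborel)"
      and g: "\<forall>h \<in> borel_measurable borel. det (matrix g) \<noteq> 0 \<longrightarrow>
        (\<integral>\<^sup>+x. h x \<partial>lborel) = ennreal \<bar>det (matrix g)\<bar> * (\<integral>\<^sup>+x. h (g x) \<partial>lborel)"
      and det: "det (matrix (f \<circ> g)) \<noteq> 0"
    have d: "det (matrix (f \<circ> g)) = det (matrix f) * det (matrix g)"
      using matrix_compose[OF lin(2,1)] by (simp add: det_mul)
    have "(\<lambda>x. h (f x)) \<in> borel_measurable borel"
      using h borel_measurable_linear[OF lin(1)] by simp
    then show "(\<integral>\<^sup>+x. h x \<partial>lborel) = ennreal \<bar>det (matrix (f \<circ> g))\<bar> * (\<integral>\<^sup>+x. h ((f \<circ> g) x) \<partial>lborel)"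
      using f[rule_format, OF h] g[rule_format, of "\<lambda>x. h (f x)"] det d
      by (simp add: abs_mult ennreal_mult mult.assoc)
  next
    fix f :: "real^'n \<Rightarrow> real^'n" and i h
    assume "linear f" and 0: "\<And>x. f x $ i = 0" and det: "det (matrix f) \<noteq> 0"
    have "row i (matrix f) = 0" using 0 by (simp add: row_def matrix_def vec_eq_iff)
    then show "(\<integral>\<^sup>+x. h x \<partial>lborel) = ennreal \<bar>det (matrix f)\<bar> * (\<integral>\<^sup>+x. h (f x) \<partial>lborel)"
      using det det_zero_row(2) by blast
  next
    fix c :: "'n \<Rightarrow> real" and h :: "real^'n \<Rightarrow> ennreal"
    assume h: "h \<in> borel_measurable borel" and det: "det (matrix (\<lambda>x. \<chi> i. c i * x $ i)) \<noteq> 0"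
    have d: "det (matrix (\<lambda>x. \<chi> i. c i * x $ i)) = prod c UNIV"
      by (simp add: axis_def matrix_def det_diagonal)
    \<comment> \<open>The scaling factors, indexed by basis vectors:
      \<open>c' (axis i 1) = c i\<close>.\<close>
    define c' :: "real^'n \<Rightarrow> real" where "c' b = (\<chi> i. c i) \<bullet> b" for b
    have B: "Basis = range (\<lambda>i::'n. axis i (1::real))" by (auto simp: Basis_vec_def)
    have inj: "inj (\<lambda>i::'n. axis i (1::real))" by (auto simp: inj_def axis_eq_axis)
    have T: "(\<lambda>x. 0 + (\<Sum>j\<in>Basis. (c' j * (x \<bullet> j)) *\<^sub>R j)) = (\<lambda>x. \<chi> i. c i * x $ i)"
      unfolding B sum.reindex[OF inj] c'_def
      by (simp add: inner_axis fun_eq_iff vec_eq_iff) (simp add: axis_def if_distrib cong: if_cong)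
    have p: "(\<Prod>j\<in>Basis. \<bar>c' j\<bar>) = \<bar>prod c UNIV\<bar>"
      unfolding B prod.reindex[OF inj] c'_def by (simp add: inner_axis abs_prod)
    have nz: "\<And>j. j \<in> Basis \<Longrightarrow> c' j \<noteq> 0"
      using det d by (auto simp: B c'_def inner_axis)
    have m: "(\<lambda>x::real^'n. \<chi> i. c i * x $ i) \<in> borel_measurable borel"
      by (intro borel_measurable_continuous_onI continuous_intros)
    have eq: "lborel = density (distr lborel borel (\<lambda>x. \<chi> i. c i * x $ i)) (\<lambda>_. \<bar>prod c UNIV\<bar>)"
      using lborel_affine_euclidean[of c' 0, OF nz] unfolding T p by (simp add: p)
    show "(\<integral>\<^sup>+x. h x \<partial>lborel) = ennreal \<bar>det (matrix (\<lambda>x. \<chi> i. c i * x $ i))\<bar> * (\<integral>\<^sup>+x. h (\<chi> i. c i * x $ i) \<partial>lborel)"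
      unfolding d using h m
      by (subst eq) (simp add: nn_integral_density nn_integral_distr nn_integral_cmult)
  next
    fix m n :: 'n and h :: "real^'n \<Rightarrow> ennreal"
    assume "m \<noteq> n" and h: "h \<in> borel_measurable borel"
    let ?t = "Transposition.transpose m n"
    let ?h = "\<lambda>v::real^'n. \<chi> i. v $ ?t i"
    have "matrix ?h = (\<chi> i. (mat 1 :: real^'n^'n) $ ?t i)"
      by (auto simp: matrix_def mat_def axis_def vec_eq_iff)
    then have 1: "\<bar>det (matrix ?h)\<bar> = 1"
      by (simp add: det_permute_rows permutes_swap_id sign_swap_id abs_mult)
    have "(\<integral>\<^sup>+x. h x \<partial>lborel) = (\<integral>\<^sup>+x. h (?h x) \<partial>lborel)"
    proof (rule nn_integral_lborel_eqI[OF _ _ h])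
      show "?h \<in> borel_measurable borel"
        by (intro borel_measurable_continuous_onI continuous_intros)
      fix l u :: "real^'n" assume ne: "cbox l u \<noteq> {}"
      have "?h -` box l u = box (?h l) (?h u)"
        by (auto simp: mem_box_cart) (metis transpose_involutory)+
      moreover have "cbox (?h l) (?h u) \<noteq> {}" using ne by (simp add: interval_ne_empty_cart)
      moreover have "(\<Prod>i\<in>UNIV. u $ ?t i - l $ ?t i) = (\<Prod>i\<in>UNIV. u $ i - l $ i)"
        using prod.permute [OF permutes_swap_id, where S=UNIV and g="\<lambda>i. u$i - l$i"] by (simp add: o_def)
      ultimately show "emeasure lborel (?h -` box l u) = emeasure lborel (box l u)"
        using ne by (simp add: emeasure_lborel_box_cart)
    qed
    then show "(\<integral>\<^sup>+x. h x \<partial>lborel) = ennreal \<bar>det (matrix ?h)\<bar> * (\<integral>\<^sup>+x. h (?h x) \<partial>lborel)"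
      by (simp add: 1)
  next
    fix m n :: 'n and h :: "real^'n \<Rightarrow> ennreal"
    assume mn: "m \<noteq> n" and h: "h \<in> borel_measurable borel"
    let ?h = "\<lambda>v::real^'n. \<chi> i. if i = m then v $ m + v $ n else v $ i"
    show "(\<integral>\<^sup>+x. h x \<partial>lborel) = ennreal \<bar>det (matrix ?h)\<bar> * (\<integral>\<^sup>+x. h (?h x) \<partial>lborel)"
    proof -
      \<comment> \<open>\<open>?g\<close> is the inverse shear. Preimages of boxes under
        \<open>?g\<close> are images under \<open>?h\<close>, whose volumes are known, so the
        criterion is applied to \<open>?g\<close> with integrand \<open>h (?h x)\<close>.\<close>
      let ?g = "\<lambda>v::real^'n. \<chi> i. if i = m then v $ m - v $ n else v $ i"
      have "matrix ?h = (\<chi> k. if k = m then row m (mat 1) + 1 *s row n (mat 1) else row k (mat 1))"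
        using mn by (auto simp: matrix_def mat_def axis_def vec_eq_iff row_def)
      then have 1: "det (matrix ?h) = 1"
        using det_row_operation[OF mn, of "mat 1" 1] by simp
      have lin: "linear ?h"
        by (rule linearI) (auto simp: algebra_simps vec_eq_iff)
      have lin': "linear ?g"
        by (rule linearI) (auto simp: algebra_simps vec_eq_iff)
      have "(\<integral>\<^sup>+x. h (?h x) \<partial>lborel) = (\<integral>\<^sup>+x. h (?h (?g x)) \<partial>lborel)"
      proof (rule nn_integral_lborel_eqI)
        fix l u :: "real^'n" assume ne: "cbox l u \<noteq> {}"
        have "?g -` box l u = ?h ` box l u"
        proof (intro set_eqI iffI)
          fix x assume "x \<in> ?g -` box l u"
          moreover have "x = ?h (?g x)" using mn by (simp add: vec_eq_iff)
          ultimately show "x \<in> ?h ` box l u" by blast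
        next
          fix x assume "x \<in> ?h ` box l u"
          then obtain y where y: "x = ?h y" "y \<in> box l u" by blast
          have "?g x = y" using mn by (simp add: y(1) vec_eq_iff)
          with y(2) show "x \<in> ?g -` box l u" by (simp only: vimage_eq)
        qed
        moreover have g: "?g -` box l u \<in> sets borel"
          using measurable_sets[OF borel_measurable_linear[OF lin'], of "box l u"] by simp
        \<comment> \<open>For a linear map, volume preservation on closed boxes extends to sets of
          finite measure, here to an open box.\<close>
        moreover have im: "?h ` box l u \<in> lmeasurable \<and> 1 * measure lebesgue (box l u) = measure lebesgue (?h ` box l u)"
          by (rule measure_linear_sufficient[OF lin]) (simp_all add: measure_shear_cbox[OF mn])
        ultimately have "emeasure lebesgue (?g -` box l u) = emeasure lebesgue (box l u)"
          by (simp add: emeasure_eq_measure2 del: measure_completion emeasure_completion)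
        then show "emeasure lborel (?g -` box l u) = emeasure lborel (box l u)"
          using g by simp
      qed (use h borel_measurable_linear[OF lin] borel_measurable_linear[OF lin'] in simp_all)
      also have "(\<lambda>x. ?h (?g x)) = (\<lambda>x. x)"
        using mn by (simp add: vec_eq_iff fun_eq_iff)
      finally show ?thesis by (simp add: 1)
    qed
  qed
  then show ?thesis using assms(2,3) by blast
qed

subsection \<open>Moments of Gaussian measures\<close>

text \<open>Fubini for functions of separate coordinates. \<open>lborel\<close> is the image of a
  product measure indexed by basis vectors, so the index \<open>i\<close> is transported to
  \<open>axis i 1\<close>.\<close>

lemma has_bochner_integral_lborel_prod:
  fixes f :: "'n::finite \<Rightarrow> real \<Rightarrow> real"
  assumes "\<And>i. integrable lborel (f i)"
  shows "has_bochner_integral (lborel :: (real^'n) measure) (\<lambda>x. \<Prod>i\<in>UNIV. f i (x $ i))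
    (\<Prod>i\<in>UNIV. integral\<^sup>L lborel (f i))"
proof -
  interpret product_sigma_finite "\<lambda>_::real^'n. lborel :: real measure" by standard
  define F where "F b = f (THE i. b = axis i 1)" for b :: "real^'n"
  have F: "F (axis i 1) = f i" for i by (simp add: F_def axis_eq_axis)
  have B: "Basis = range (\<lambda>i::'n. axis i (1::real))" by (auto simp: Basis_vec_def)
  have inj: "inj (\<lambda>i::'n. axis i (1::real))" by (auto simp: inj_def axis_eq_axis)
  have intF: "integrable lborel (F b)" if "b \<in> Basis" for b
    using that assms by (auto simp: B F)
  have [measurable]: "f i \<in> borel_measurable borel" for i
    using assms[of i] by (auto dest: borel_measurable_integrable)
  have comp: "(\<Sum>b\<in>Basis. y b *\<^sub>R b) $ i = y (axis i 1)" for y :: "real^'n \<Rightarrow> real" and i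
    unfolding B sum.reindex[OF inj] by (simp add: axis_def if_distrib cong: if_cong)
  have eq: "(\<Prod>i\<in>UNIV. f i ((\<Sum>b\<in>Basis. y b *\<^sub>R b) $ i)) = (\<Prod>b\<in>Basis. F b (y b))" for y
    unfolding comp unfolding B prod.reindex[OF inj] by (simp add: F)
  have [measurable]: "(\<lambda>x::real^'n. \<Prod>i\<in>UNIV. f i (x $ i)) \<in> borel_measurable borel"
    by measurable
  have "has_bochner_integral (\<Pi>\<^sub>M b\<in>Basis. lborel) (\<lambda>y. \<Prod>b\<in>Basis. F b (y b)) (\<Prod>b\<in>Basis. integral\<^sup>L lborel (F b))"
    using product_integrable_prod[OF finite_Basis intF] product_integral_prod[OF finite_Basis intF]
    by (simp add: has_bochner_integral_iff)
  also have "(\<Prod>b\<in>Basis. integral\<^sup>L lborel (F b)) = (\<Prod>i\<in>UNIV. integral\<^sup>L lborel (f i))"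
    unfolding B prod.reindex[OF inj] by (simp add: F)
  finally show ?thesis
    unfolding lborel_eq[where 'a = "real^'n"]
    by (intro has_bochner_integral_distr) (simp_all only: eq, measurable)
qed

text \<open>The standard density is the product of one-dimensional normal densities, which reduces
  joint moments to moments on the line.\<close>

lemma has_bochner_integral_std_gaussian_prod:
  fixes f :: "'n::finite \<Rightarrow> real \<Rightarrow> real"
  assumes [measurable]: "\<And>i. f i \<in> borel_measurable borel"
    and "\<And>i. has_bochner_integral lborel (\<lambda>t. std_normal_density t * f i t) (m i)"
  shows "has_bochner_integral (gaussian_measure 0 (mat 1 :: real^'n^'n)) (\<lambda>x. \<Prod>i\<in>UNIV. f i (x $ i)) (\<Prod>i\<in>UNIV. m i)"
proof -
  have inv: "matrix_inv (mat 1 :: real^'n^'n) = mat 1" by (rule matrix_inv_eqI) simp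
  have dens: "exp (- (1/2) * (x \<bullet> x)) / sqrt ((2 * pi) ^ CARD('n)) = (\<Prod>i\<in>UNIV. std_normal_density (x $ i))" for x :: "real^'n"
    by (simp add: std_normal_density_def prod_dividef real_sqrt_power real_sqrt_mult inner_vec_def sum_divide_distrib
        sum_negf power2_eq_square exp_sum[symmetric] power_mult_distrib)
  have "has_bochner_integral (lborel :: (real^'n) measure) (\<lambda>x. \<Prod>i\<in>UNIV. std_normal_density (x $ i) * f i (x $ i)) (\<Prod>i\<in>UNIV. m i)"
    using has_bochner_integral_lborel_prod[of "\<lambda>i t. std_normal_density t * f i t"] assms(2)
    by (simp add: has_bochner_integral_iff)
  then show ?thesis
    unfolding gaussian_measure_def
    by (intro has_bochner_integral_density) (simp_all add: inv dens[simplified] prod.distrib prod_nonneg)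
qed

lemma std_gaussian_moments:
  shows "has_bochner_integral (gaussian_measure 0 (mat 1 :: real^'n^'n)) (\<lambda>x. 1) (1::real)"
    and "has_bochner_integral (gaussian_measure 0 (mat 1 :: real^'n^'n)) (\<lambda>x. x $ i) (0::real)"
    and "has_bochner_integral (gaussian_measure 0 (mat 1 :: real^'n^'n)) (\<lambda>x. x $ i * x $ j) (if i = j then 1 else 0)"
proof -
  have m0: "has_bochner_integral lborel std_normal_density 1"
    using std_normal_moment_even[of 0] by simp
  have m1: "has_bochner_integral lborel (\<lambda>t. std_normal_density t * t) 0"
    using std_normal_moment_odd[of 0] by simp
  have m2: "has_bochner_integral lborel (\<lambda>t. std_normal_density t * (t * t)) 1"
    using std_normal_moment_even[of 1] by (simp add: power2_eq_square)
  show "has_bochner_integral (gaussian_measure 0 (mat 1 :: real^'n^'n)) (\<lambda>x. 1) (1::real)"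
    using has_bochner_integral_std_gaussian_prod[of "\<lambda>_ _. 1" "\<lambda>_::'n. 1"] m0 by simp
  have "has_bochner_integral (gaussian_measure 0 (mat 1 :: real^'n^'n))
      (\<lambda>x. \<Prod>k\<in>UNIV. if k = i then x $ k else 1) (\<Prod>k\<in>UNIV. if k = i then 0 else 1)"
    using m0 m1 by (intro has_bochner_integral_std_gaussian_prod[of "\<lambda>k t. if k = i then t else 1"]) auto
  then show "has_bochner_integral (gaussian_measure 0 (mat 1 :: real^'n^'n)) (\<lambda>x. x $ i) (0::real)"
    by simp
  \<comment> \<open>Coordinate \<open>k\<close> contributes the mean of \<open>1\<close> or of
    \<open>t * t\<close>, which is 1, when it matches both or neither of \<open>i\<close> and
    \<open>j\<close>, and the mean of \<open>t\<close>, which is 0, otherwise.\<close>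
  have "has_bochner_integral (gaussian_measure 0 (mat 1 :: real^'n^'n))
      (\<lambda>x. \<Prod>k\<in>UNIV. (if k = i then x $ k else 1) * (if k = j then x $ k else 1))
      (\<Prod>k\<in>UNIV. if k = i \<longleftrightarrow> k = j then 1 else 0)"
    using m0 m1 m2
    by (intro has_bochner_integral_std_gaussian_prod[of "\<lambda>k t. (if k = i then t else 1) * (if k = j then t else 1)"]) auto
  moreover have "(\<Prod>k\<in>UNIV. if k = i \<longleftrightarrow> k = j then 1 else 0) = (if i = j then 1 else 0 :: real)"
    by auto
  ultimately show "has_bochner_integral (gaussian_measure 0 (mat 1 :: real^'n^'n)) (\<lambda>x. x $ i * x $ j) (if i = j then 1 else 0)"
    by (simp add: prod.distrib)
qed

lemma sets_gaussian_measure [measurable_cong, simp]: "sets (gaussian_measure a S) = sets borel"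
  by (simp add: gaussian_measure_def)

lemma space_gaussian_measure [simp]: "space (gaussian_measure a S) = UNIV"
  by (simp add: gaussian_measure_def)

lemma borel_measurable_matrix_vector_mult [measurable (raw)]:
  fixes A :: "real^'n^'m"
  shows "f \<in> borel_measurable M \<Longrightarrow> (\<lambda>x. A *v f x) \<in> borel_measurable M"
  using borel_measurable_linear[OF matrix_vector_mul_linear, of A] by (rule measurable_compose[rotated])

text \<open>Under \<open>x = L z + a\<close> the quadratic form becomes
  \<open>z \<bullet> z\<close>, and the Jacobian \<open>\<bar>det L\<bar>\<close> cancels the square
  root of \<open>det (L L\<^sup>T)\<close> in the normalization.\<close>

lemma gaussian_measure_affine:
  fixes L :: "real^'n^'n"
  assumes "invertible L"
  shows "gaussian_measure a (L ** transpose L) = distr (gaussian_measure 0 (mat 1)) borel (\<lambda>z. L *v z + a)"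
proof (rule measure_eqI)
  let ?S = "L ** transpose L" and ?T = "\<lambda>z. L *v z + a"
  let ?d = "\<lambda>a S (x::real^'n). ennreal (exp (- (1/2) * ((x - a) \<bullet> (matrix_inv S *v (x - a)))) / sqrt ((2 * pi) ^ CARD('n) * det S))"
  fix A assume "A \<in> sets (gaussian_measure a ?S)"
  then have [measurable]: "A \<in> sets borel" by simp
  have det: "det L \<noteq> 0" using assms by (simp add: invertible_det_nz)
  note inv = matrix_inv_both[OF assms]
  have inv': "transpose L ** transpose (matrix_inv L) = mat 1"
    by (simp add: inv flip: matrix_transpose_mul)
  have "(L ** transpose L) ** (transpose (matrix_inv L) ** matrix_inv L) = mat 1"
    by (metis inv' inv(1) matrix_mul_assoc matrix_mul_rid)
  then have "matrix_inv ?S = transpose (matrix_inv L) ** matrix_inv L"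
    by (rule matrix_inv_eqI)
  then have q: "(L *v z) \<bullet> (matrix_inv ?S *v (L *v z)) = z \<bullet> z" for z
    by (simp add: inner_matrix_vector_mult matrix_vector_mul_assoc[symmetric] del: transpose_matrix_vector)
       (simp add: matrix_vector_mul_assoc inv inv' del: transpose_matrix_vector)
  have i1: "matrix_inv (mat 1 :: real^'n^'n) = mat 1" by (rule matrix_inv_eqI) simp
  have d: "ennreal \<bar>det L\<bar> * ?d a ?S (?T z) = ?d 0 (mat 1) z" for z
    using det by (subst ennreal_mult[symmetric])
      (simp_all add: q i1 det_mul real_sqrt_mult real_sqrt_mult_self mult.assoc)
  have "emeasure (gaussian_measure a ?S) A = (\<integral>\<^sup>+x. ?d a ?S x * indicator A x \<partial>lborel)"
    by (simp add: gaussian_measure_def emeasure_density)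
  \<comment> \<open>Translation invariance absorbs \<open>a\<close>, leaving a purely linear change
    of variables.\<close>
  also have "\<dots> = (\<integral>\<^sup>+x. ?d a ?S x * indicator A x \<partial>distr lborel borel ((+) a))"
    by (simp only: lborel_distr_plus)
  also have "\<dots> = (\<integral>\<^sup>+x. ?d a ?S (x + a) * indicator A (x + a) \<partial>lborel)"
    by (subst nn_integral_distr) (auto simp: add.commute)
  also have "\<dots> = ennreal \<bar>det L\<bar> * (\<integral>\<^sup>+z. ?d a ?S (?T z) * indicator A (?T z) \<partial>lborel)"
    using nn_integral_linear_image[OF matrix_vector_mul_linear, of L "\<lambda>x. ?d a ?S (x + a) * indicator A (x + a)"] det
    by simp
  also have "\<dots> = (\<integral>\<^sup>+z. ?d 0 (mat 1) z * indicator (?T -` A) z \<partial>lborel)"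
    by (subst nn_integral_cmult[symmetric], measurable)
      (auto intro!: nn_integral_cong simp: mult.assoc[symmetric] d[simplified] split: split_indicator)
  also have "\<dots> = emeasure (gaussian_measure 0 (mat 1)) (?T -` A)"
  proof -
    have "?T -` A \<inter> space borel \<in> sets borel" by (rule measurable_sets) measurable
    then show ?thesis by (simp add: gaussian_measure_def emeasure_density)
  qed
  finally show "emeasure (gaussian_measure a ?S) A = emeasure (distr (gaussian_measure 0 (mat 1)) borel ?T) A"
    by (simp add: emeasure_distr)
qed simp

lemma inner_matrix_sum:
  fixes M :: "real^'n^'n"
  shows "z \<bullet> (M *v z) = (\<Sum>i\<in>UNIV. \<Sum>j\<in>UNIV. M $ i $ j * (z $ i * z $ j))"
  by (simp add: inner_vec_def matrix_vector_mult_def sum_distrib_left mult_ac)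

text \<open>Linear and off-diagonal terms have mean 0; each diagonal entry is weighted by variance
  1.\<close>

lemma std_gaussian_quadratic:
  fixes M :: "real^'n^'n" and w :: "real^'n"
  shows "has_bochner_integral (gaussian_measure 0 (mat 1)) (\<lambda>z. z \<bullet> (M *v z) + w \<bullet> z + c) (trace M + c)"
proof -
  have "has_bochner_integral (gaussian_measure 0 (mat 1))
     (\<lambda>z. (\<Sum>i\<in>UNIV. \<Sum>j\<in>UNIV. M $ i $ j * (z $ i * z $ j)) + (\<Sum>i\<in>UNIV. w $ i * z $ i) + c * 1)
     ((\<Sum>i\<in>UNIV. \<Sum>j\<in>UNIV. M $ i $ j * (if i = j then 1 else 0)) + (\<Sum>i\<in>UNIV. w $ i * 0) + c * 1)"
    by (intro has_bochner_integral_add has_bochner_integral_sum has_bochner_integral_mult_right std_gaussian_moments)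
  then show ?thesis
    unfolding inner_matrix_sum by (simp add: inner_vec_def[of w] trace_def if_distrib cong: if_cong)
qed

text \<open>With \<open>x - c = L z + d\<close> the cross terms are linear in \<open>z\<close> and
  average out, and cyclicity turns \<open>tr (L\<^sup>T Q L)\<close> into
  \<open>tr (Q S)\<close>.\<close>

proposition gaussian_quadratic:
  fixes Q S :: "real^'n^'n"
  assumes "spd S"
  shows "has_bochner_integral (gaussian_measure a S) (\<lambda>x. (x - c) \<bullet> (Q *v (x - c)))
    (trace (Q ** S) + (a - c) \<bullet> (Q *v (a - c)))"
proof -
  obtain L :: "real^'n^'n" where L: "invertible L" "S = L ** transpose L"
    using spd_factor_exists[OF assms] .
  define d where "d = a - c"
  have "has_bochner_integral (gaussian_measure 0 (mat 1))
     (\<lambda>z. (L *v z + a - c) \<bullet> (Q *v (L *v z + a - c))) (trace (transpose L ** Q ** L) + d \<bullet> (Q *v d))"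
  proof -
    \<comment> \<open>\<open>Q\<close> need not be symmetric, so the two cross terms yield both
      \<open>Q *v d\<close> and \<open>transpose Q *v d\<close>.\<close>
    have "(\<lambda>z. (L *v z + a - c) \<bullet> (Q *v (L *v z + a - c))) =
      (\<lambda>z. z \<bullet> ((transpose L ** Q ** L) *v z) + (transpose L *v (Q *v d + transpose Q *v d)) \<bullet> z + d \<bullet> (Q *v d))"
    proof
      fix z
      have "(L *v z + a - c) \<bullet> (Q *v (L *v z + a - c)) = (L *v z + d) \<bullet> (Q *v (L *v z + d))"
        by (simp add: d_def algebra_simps)
      also have "\<dots> = (L *v z) \<bullet> (Q *v (L *v z)) + (L *v z) \<bullet> (Q *v d) + d \<bullet> (Q *v (L *v z)) + d \<bullet> (Q *v d)"
        by (simp add: matrix_vector_right_distrib inner_add_left inner_add_right)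
      also have "(L *v z) \<bullet> (Q *v (L *v z)) = z \<bullet> ((transpose L ** Q ** L) *v z)"
        by (simp add: inner_matrix_vector_mult[of z] matrix_vector_mul_assoc[symmetric] del: transpose_matrix_vector)
      also have "(L *v z) \<bullet> (Q *v d) = (transpose L *v (Q *v d)) \<bullet> z"
        using inner_matrix_vector_mult[of "Q *v d" L z] by (simp add: inner_commute)
      also have "d \<bullet> (Q *v (L *v z)) = (transpose L *v (transpose Q *v d)) \<bullet> z"
        by (simp only: inner_matrix_vector_mult)
      finally show "(L *v z + a - c) \<bullet> (Q *v (L *v z + a - c)) =
         z \<bullet> ((transpose L ** Q ** L) *v z) + (transpose L *v (Q *v d + transpose Q *v d)) \<bullet> z + d \<bullet> (Q *v d)"
        by (simp add: matrix_vector_right_distrib inner_add_left del: transpose_matrix_vector)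
    qed
    then show ?thesis using std_gaussian_quadratic by simp
  qed
  moreover have "trace (transpose L ** Q ** L) = trace (Q ** S)"
    by (metis L(2) matrix_mul_assoc trace_mul_sym)
  ultimately show ?thesis
    unfolding L(2) gaussian_measure_affine[OF L(1)]
    by (subst has_bochner_integral_distr) (simp_all add: d_def L(2))
qed

lemma prob_space_gaussian_measure:
  fixes S :: "real^'n^'n"
  assumes "spd S"
  shows "prob_space (gaussian_measure a S)"
proof -
  obtain L :: "real^'n^'n" where L: "invertible L" "S = L ** transpose L"
    using spd_factor_exists[OF assms] .
  have "prob_space (gaussian_measure 0 (mat 1 :: real^'n^'n))"
  proof
    let ?G = "gaussian_measure 0 (mat 1 :: real^'n^'n)"
    have "measure ?G UNIV = 1"
      using std_gaussian_moments(1)[where 'n='n] by (simp add: has_bochner_integral_iff)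
    \<comment> \<open>\<open>measure\<close> maps infinite mass to 0, so the value 1 certifies
      finiteness.\<close>
    moreover from this have "emeasure ?G UNIV \<noteq> top"
      by (auto simp: measure_def)
    ultimately show "emeasure ?G (space ?G) = 1"
      by (simp add: emeasure_eq_ennreal_measure)
  qed
  then show ?thesis
    unfolding L(2) gaussian_measure_affine[OF L(1)]
    by (rule prob_space.prob_space_distr) simp
qed

subsection \<open>Information gain\<close>

lemma has_bochner_integral_const_prob:
  fixes c :: real
  assumes "prob_space M"
  shows "has_bochner_integral M (\<lambda>_. c) c"
proof -
  interpret prob_space M by fact
  show ?thesis by (simp add: has_bochner_integral_iff prob_space)
qed

text \<open>The log-ratio of the densities is a difference of two quadratic forms plus
  log-normalizers, in which the powers of \<open>2 * pi\<close> cancel. The form of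
  \<open>S1\<close> about its own mean averages to \<open>tr (S1\<^sup>-\<^sup>1 S1)\<close>, the
  source of the dimension term.\<close>

proposition D_kl_gaussian_measure:
  fixes S1 S2 :: "real^'n^'n"
  assumes "spd S1" "spd S2"
  shows "D_kl (gaussian_measure a1 S1) (gaussian_measure a2 S2) =
    1/2 * (ln (det S2) - ln (det S1) - CARD('n) + trace (matrix_inv S2 ** S1)
      + (a1 - a2) \<bullet> (matrix_inv S2 *v (a1 - a2)))"
proof -
  define q :: "real^'n \<Rightarrow> real^'n^'n \<Rightarrow> real^'n \<Rightarrow> real"
    where "q a S x = (x - a) \<bullet> (matrix_inv S *v (x - a))" for a S x
  define Z where "Z S = sqrt ((2 * pi) ^ CARD('n) * det S)" for S :: "real^'n^'n"
  define d where "d a S x = exp (- (1/2) * q a S x) / Z S" for a S x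
  have G: "gaussian_measure a S = density lborel (\<lambda>x. ennreal (d a S x))" for a S
    by (simp add: gaussian_measure_def d_def q_def Z_def)
  have Z: "0 < Z S" "ln (Z S) = 1/2 * (ln ((2 * pi) ^ CARD('n)) + ln (det S))" if "spd S" for S
    using spd_det_pos[OF that] by (simp_all add: Z_def ln_sqrt ln_mult)
  have [measurable]: "d a S \<in> borel_measurable borel" for a S
    unfolding d_def q_def by measurable
  have pos: "0 < d a S x" if "spd S" for a S x using Z(1)[OF that] by (simp add: d_def)
  have lnd: "ln (d a S x) = - (1/2) * q a S x - ln (Z S)" if "spd S" for a S x
    using Z(1)[OF that] by (simp add: d_def ln_div)
  have "D_kl (gaussian_measure a1 S1) (gaussian_measure a2 S2) =
     (\<integral>x. d a1 S1 x * log (exp 1) (d a1 S1 x / d a2 S2 x) \<partial>lborel)"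
    unfolding D_kl_def G using pos[OF assms(1)] pos[OF assms(2)]
    by (intro lborel.KL_density_density) (auto simp: less_imp_le less_imp_neq[symmetric])
  also have "\<dots> = (\<integral>x. ln (d a1 S1 x / d a2 S2 x) \<partial>gaussian_measure a1 S1)"
    unfolding G using pos[OF assms(1)] 
    by (subst integral_density) (auto simp: less_imp_le log_def)
  also have "(\<lambda>x. ln (d a1 S1 x / d a2 S2 x)) = (\<lambda>x. 1/2 * q a2 S2 x - 1/2 * q a1 S1 x + (ln (Z S2) - ln (Z S1)))"
    using pos[OF assms(1), THEN less_imp_neq, symmetric] pos[OF assms(2), THEN less_imp_neq, symmetric]
    by (simp add: fun_eq_iff ln_div lnd assms pos)
  also have "(\<integral>x. 1/2 * q a2 S2 x - 1/2 * q a1 S1 x + (ln (Z S2) - ln (Z S1)) \<partial>gaussian_measure a1 S1) =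
     1/2 * (trace (matrix_inv S2 ** S1) + (a1 - a2) \<bullet> (matrix_inv S2 *v (a1 - a2)))
     - 1/2 * (trace (matrix_inv S1 ** S1) + (a1 - a1) \<bullet> (matrix_inv S1 *v (a1 - a1))) + (ln (Z S2) - ln (Z S1))"
    unfolding q_def
    by (intro has_bochner_integral_integral_eq has_bochner_integral_add has_bochner_integral_diff
        has_bochner_integral_mult_right gaussian_quadratic has_bochner_integral_const_prob
        prob_space_gaussian_measure assms)
  also have "matrix_inv S1 ** S1 = mat 1"
    using matrix_inv_both(2)[OF spd_invertible[OF assms(1)]] .
  finally show ?thesis
    by (simp add: Z assms trace_I field_simps)
qed

text \<open>With \<open>H = M\<^sup>T N\<^sup>-\<^sup>1 M\<close>, so that \<open>P (H + C\<^sup>-\<^sup>1) = 1\<close>, the last two traces add up to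
  \<open>tr (C\<^sup>-\<^sup>1 K (N + M C M\<^sup>T) K\<^sup>T) = tr (P H)\<close>, because
  \<open>K (N + M C M\<^sup>T) K\<^sup>T = P (H + H C H) P = P H C (C\<^sup>-\<^sup>1 + H) P = P H C\<close>.\<close>

lemma trace_posterior_identity:
  fixes M :: "real^'n^'q" and N :: "real^'q^'q" and C :: "real^'n^'n"
  assumes "spd N" "spd C"
  defines "P \<equiv> matrix_inv (transpose M ** matrix_inv N ** M + matrix_inv C)"
  defines "K \<equiv> P ** (transpose M ** matrix_inv N)"
  defines "Q \<equiv> transpose K ** matrix_inv C ** K"
  shows "trace (matrix_inv C ** P) + trace (Q ** N) + trace (transpose M ** Q ** M ** C) = CARD('n)"
proof -
  define H where "H = transpose M ** matrix_inv N ** M"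
  have spdA: "spd (H + matrix_inv C)"
    unfolding H_def using assms by (intro spd_add_congruence spd_matrix_inv)
  note invN = matrix_inv_both[OF spd_invertible[OF \<open>spd N\<close>]]
  note invC = matrix_inv_both[OF spd_invertible[OF \<open>spd C\<close>]]
  have P: "P ** (H + matrix_inv C) = mat 1" "(H + matrix_inv C) ** P = mat 1"
    using matrix_inv_both[OF spd_invertible[OF spdA]] by (simp_all add: P_def H_def)
  have symN: "transpose (matrix_inv N) = matrix_inv N"
    using spd_matrix_inv[OF \<open>spd N\<close>] by (simp add: spd_def)
  have "spd P" unfolding P_def using spd_matrix_inv[OF spdA] by (simp add: H_def)
  then have symP: "transpose P = P" by (simp add: spd_def)
  have tK: "transpose K = matrix_inv N ** M ** P"
    by (simp add: K_def matrix_transpose_mul symN symP)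
  have KNK: "K ** N ** transpose K = P ** H ** P"
  proof -
    have "K ** N ** transpose K = P ** transpose M ** (matrix_inv N ** N) ** matrix_inv N ** M ** P"
      unfolding tK unfolding K_def by (simp add: matrix_mul_assoc)
    then show ?thesis by (simp add: invN H_def matrix_mul_assoc)
  qed
  have KM: "K ** M = P ** H" by (simp add: K_def H_def matrix_mul_assoc)
  have MK: "transpose M ** transpose K = H ** P"
    by (simp add: tK H_def matrix_mul_assoc)
  have "trace (Q ** N) = trace (matrix_inv C ** (K ** N ** transpose K))"
    by (metis Q_def matrix_mul_assoc trace_mul_sym)
  also have "\<dots> = trace (matrix_inv C ** P ** H ** P)" by (simp add: KNK matrix_mul_assoc)
  finally have 1: "trace (Q ** N) = trace (matrix_inv C ** P ** H ** P)" .
  have "transpose M ** Q ** M ** C = (transpose M ** transpose K) ** matrix_inv C ** (K ** M) ** C"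
    by (simp add: Q_def matrix_mul_assoc)
  also have "\<dots> = (H ** P) ** (matrix_inv C ** P ** H ** C)"
    by (simp add: KM MK matrix_mul_assoc)
  finally have "trace (transpose M ** Q ** M ** C) = trace ((matrix_inv C ** P ** H ** C) ** (H ** P))"
    by (simp add: trace_mul_sym[of "H ** P"])
  then have 2: "trace (transpose M ** Q ** M ** C) = trace (matrix_inv C ** P ** H ** C ** H ** P)"
    by (simp add: matrix_mul_assoc)
  \<comment> \<open>Inserting \<open>C C\<^sup>-\<^sup>1\<close> into the noise term exposes a
    common left factor; what remains is \<open>(C\<^sup>-\<^sup>1 + H) P = 1\<close>.\<close>
  have "matrix_inv C ** P ** H ** P + matrix_inv C ** P ** H ** C ** H ** P
      = matrix_inv C ** P ** H ** C ** ((matrix_inv C + H) ** P)"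
  proof -
    have "matrix_inv C ** P ** H ** C ** (matrix_inv C ** P) = matrix_inv C ** P ** H ** (C ** matrix_inv C) ** P"
      by (simp only: matrix_mul_assoc)
    then show ?thesis
      by (simp add: invC matrix_add_rdistrib matrix_add_ldistrib matrix_mul_assoc)
  qed
  also have "\<dots> = matrix_inv C ** (P ** H ** C)"
    using P(2) by (simp add: add.commute matrix_mul_assoc)
  finally have "trace (Q ** N) + trace (transpose M ** Q ** M ** C) = trace (matrix_inv C ** (P ** H ** C))"
    by (simp add: 1 2 trace_add[symmetric])
  also have "\<dots> = trace (P ** H ** (C ** matrix_inv C))"
    by (metis matrix_mul_assoc trace_mul_sym)
  also have "\<dots> = trace (P ** H)" by (simp add: invC)
  finally have "trace (matrix_inv C ** P) + trace (Q ** N) + trace (transpose M ** Q ** M ** C)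
      = trace (P ** matrix_inv C) + trace (P ** H)"
    by (simp add: trace_mul_sym[of "matrix_inv C"])
  also have "\<dots> = trace (P ** (H + matrix_inv C))"
    by (simp add: matrix_add_ldistrib trace_add)
  finally show ?thesis by (simp add: P trace_I)
qed

text \<open>Writing \<open>a\<close> as posterior covariance times posterior precision times
  \<open>a\<close> cancels the prior term and leaves the gain matrix applied to the residual
  \<open>y - F a\<close>.\<close>

lemma post_mean_diff_prior_mean:
  assumes "linear F" "spd N" "spd C"
  shows "post_mean F N C a y - a = (post_cov F N C ** (transpose (matrix F) ** matrix_inv N)) *v (y - F a)"
proof -
  let ?M = "matrix F"
  let ?A = "transpose ?M ** matrix_inv N ** ?M + matrix_inv C"
  have inv: "matrix_inv ?A ** ?A = mat 1"
    using assms by (intro matrix_inv_both spd_invertible spd_add_congruence spd_matrix_inv)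
  have F: "F a = ?M *v a" using assms(1) by (simp add: matrix_works)
  have "a = matrix_inv ?A *v (?A *v a)" by (simp add: matrix_vector_mul_assoc inv)
  also have "?A *v a = (transpose ?M ** matrix_inv N) *v (F a) + matrix_inv C *v a"
    by (simp add: matrix_vector_mult_add_rdistrib F matrix_vector_mul_assoc matrix_mul_assoc del: transpose_matrix_vector)
  finally have a: "a = matrix_inv ?A *v \<dots>" .
  show ?thesis
    unfolding post_mean_def post_cov_def
    by (subst (2) a) (simp add: matrix_vector_mul_assoc[symmetric] matrix_vector_mult_diff_distrib matrix_vector_right_distrib del: transpose_matrix_vector)
qed

theorem theorem3p2:
  fixes F :: "real^'n \<Rightarrow> real^'q"
    and \<Gamma>noise :: "real^'q^'q"
    and \<Gamma>pr :: "real^'n^'n"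
    and mpr :: "real^'n"
  assumes "linear F"
    and "spd \<Gamma>noise"
    and "spd \<Gamma>pr"
  shows "expected_information_gain F \<Gamma>noise \<Gamma>pr mpr =
    - (1/2) * ln (det (post_cov F \<Gamma>noise \<Gamma>pr)) + (1/2) * ln (det \<Gamma>pr)"
proof -
  let ?M = "matrix F"
  define P where "P = post_cov F \<Gamma>noise \<Gamma>pr"
  define K where "K = P ** (transpose ?M ** matrix_inv \<Gamma>noise)"
  \<comment> \<open>Chosen so that the prior-precision form at \<open>K *v r\<close> is
    \<open>r \<bullet> (Q *v r)\<close> for a residual \<open>r\<close>.\<close>
  define Q where "Q = transpose K ** matrix_inv \<Gamma>pr ** K"
  \<comment> \<open>The part of twice the divergence that does not depend on the data.\<close>
  define c where "c = ln (det \<Gamma>pr) - ln (det P) - CARD('n) + trace (matrix_inv \<Gamma>pr ** P)"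
  have spdP: "spd P"
    unfolding P_def post_cov_def using assms
    by (intro spd_matrix_inv spd_add_congruence)
  have F: "F x - F y = ?M *v (x - y)" for x y
    using assms(1) by (simp add: matrix_works linear_diff)
  have KL: "D_kl (posterior F \<Gamma>noise \<Gamma>pr mpr y) (gaussian_measure mpr \<Gamma>pr) =
      1/2 * (c + (y - F mpr) \<bullet> (Q *v (y - F mpr)))" for y
  proof -
    have "D_kl (posterior F \<Gamma>noise \<Gamma>pr mpr y) (gaussian_measure mpr \<Gamma>pr) =
      1/2 * (c + (K *v (y - F mpr)) \<bullet> (matrix_inv \<Gamma>pr *v (K *v (y - F mpr))))"
      using D_kl_gaussian_measure[OF spdP assms(3)] post_mean_diff_prior_mean[OF assms, of mpr y]
      by (simp add: posterior_def c_def P_def K_def del: transpose_matrix_vector)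
    also have "(K *v (y - F mpr)) \<bullet> (matrix_inv \<Gamma>pr *v (K *v (y - F mpr))) = (y - F mpr) \<bullet> (Q *v (y - F mpr))"
      by (simp add: Q_def inner_matrix_vector_mult[of "y - F mpr"] inner_matrix_vector_mult[of "K *v (y - F mpr)"]
          matrix_vector_mul_assoc[symmetric] matrix_transpose_mul del: transpose_matrix_vector)
    finally show ?thesis .
  qed
  have inner: "(LINT y|gaussian_measure (F m) \<Gamma>noise. D_kl (posterior F \<Gamma>noise \<Gamma>pr mpr y) (gaussian_measure mpr \<Gamma>pr))
     = 1/2 * (c + (trace (Q ** \<Gamma>noise) + (m - mpr) \<bullet> ((transpose ?M ** Q ** ?M) *v (m - mpr))))" for m
  proof -
    \<comment> \<open>Pulling the form back along \<open>F\<close> makes the inner mean a quadratic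
      form in \<open>m - mpr\<close>, ready for the second averaging.\<close>
    have "(F m - F mpr) \<bullet> (Q *v (F m - F mpr)) = (m - mpr) \<bullet> ((transpose ?M ** Q ** ?M) *v (m - mpr))"
      unfolding F
      by (simp add: inner_matrix_vector_mult[of "m - mpr"] matrix_vector_mul_assoc[symmetric] del: transpose_matrix_vector)
    moreover have "has_bochner_integral (gaussian_measure (F m) \<Gamma>noise) (\<lambda>y. 1/2 * (c + (y - F mpr) \<bullet> (Q *v (y - F mpr))))
       (1/2 * (c + (trace (Q ** \<Gamma>noise) + (F m - F mpr) \<bullet> (Q *v (F m - F mpr)))))"
      using assms(2) by (intro has_bochner_integral_mult_right has_bochner_integral_add gaussian_quadratic
        has_bochner_integral_const_prob prob_space_gaussian_measure)
    ultimately show ?thesis unfolding KL by (simp only: has_bochner_integral_integral_eq)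
  qed
  \<comment> \<open>The form is centred at the prior mean, so the outer expectation adds only a
    trace and a vanishing remainder.\<close>
  have "expected_information_gain F \<Gamma>noise \<Gamma>pr mpr = 1/2 * (c + (trace (Q ** \<Gamma>noise) +
     (trace (transpose ?M ** Q ** ?M ** \<Gamma>pr) + (mpr - mpr) \<bullet> ((transpose ?M ** Q ** ?M) *v (mpr - mpr)))))"
    unfolding expected_information_gain_def inner using assms(3)
    by (intro has_bochner_integral_integral_eq has_bochner_integral_mult_right has_bochner_integral_add gaussian_quadratic
        has_bochner_integral_const_prob prob_space_gaussian_measure)
  moreover have "trace (matrix_inv \<Gamma>pr ** P) + trace (Q ** \<Gamma>noise) + trace (transpose ?M ** Q ** ?M ** \<Gamma>pr) = CARD('n)"
    using trace_posterior_identity[OF assms(2,3), of ?M]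
    by (simp add: Q_def K_def P_def post_cov_def)
  ultimately show ?thesis by (simp add: c_def P_def)
qed

end
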